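(* Let $\mathcal{N}\subseteq\mathbb{Z}^d$ be a non-empty finite set and let $F$ be the binary CA with spreading $0$ and neighbourhood $\mathcal{N}$. Let $p,q\in[0,1]$ and let $\Phi$ be the PCA obtained by combining $F$ with the zero-range noise with transition probabilities $0\to1$ with probability $p$ and $1\to0$ with probability $q$. If $p+|1-p-q|<1$, then $\Phi$ is uniformly ergodic. Moreover, under the same condition, the unique invariant measure of $\Phi$ is spatially mixing.
   Context: Let $S=\{0,1\}$, $d\ge1$, $\mathcal{X}=S^{\mathbb{Z}^d}$ with the product topology. For finite $K\subseteq\mathbb{Z}^d$ and $y_K\in S^K$, the cylinder $[y_K]$ is $\{x\in\mathcal{X}: x_k=y_k\ \forall k\in K\}$. The shift is $(\sigma^k x)_i=x_{k+i}$. The binary CA with spreading $0$ and neighbourhood $\mathcal{N}$ is the map $F$ with $(Fx)_i=0$ if $x_{i+j}=0$ for some $j\in\mathcal{N}$, and $(Fx)_i=1$ otherwise. With noise matrix $\theta=\begin{pmatrix}1-p&p\\ q&1-q\end{pmatrix}$ (rows and columns indexed by $0,1$), $\Phi$ is the Markov kernel on $\mathcal{X}$ given by $\Phi(x,[y_K])=\prod_{k\in K}\theta\big((Fx)_k,y_k\big)$ for every cylinder. A Borel probability measure $\pi$ is invariant if $\pi\Phi=\pi$. $\Phi$ is uniformly ergodic if it has a unique invariant measure $\pi$ and $\Phi^t(x,[u])\to\pi([u])$ as $t\to\infty$, uniformly in $x\in\mathcal{X}$, for each cylinder $[u]$. $\pi$ is spatially mixing if $\lim_{k\to\infty}\pi([u]\cap\sigma^{-k}[v])=\pi([u])\pi([v])$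 for all cylinders $[u],[v]$. *)

theory Defs
  imports "HOL-Probability.Probability"
begin

text \<open>
  The lattice \<open>\<int>\<^sup>d\<close> is the type \<open>int ^ 'd\<close>, so that \<open>d = CARD('d) \<ge> 1\<close> is arbitrary.  The alphabet
  \<open>S = {0, 1}\<close> is \<^typ>\<open>bool\<close> (\<open>False\<close> for \<open>0\<close>, \<open>True\<close> for \<open>1\<close>), which carries the discrete topology;
  a configuration is then a function, and the library topology on the function type is the
  product topology, whose Borel sets are those of \<^term>\<open>borel\<close>.
\<close>

type_synonym 'd config = "int ^ 'd \<Rightarrow> bool"

text \<open>
  Only the values of \<open>y\<close> on \<open>K\<close> matter, so a pattern \<open>y\<^sub>K \<in> S\<^sup>K\<close> is represented by any total
  extension of it.
\<close>

definition cylinder :: "(int ^ 'd) set \<Rightarrow> 'd config \<Rightarrow> 'd config set" where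
  "cylinder K y = {x. \<forall>k\<in>K. x k = y k}"

definition shift :: "int ^ 'd \<Rightarrow> 'd config \<Rightarrow> 'd config" where
  "shift k x = (\<lambda>i. x (k + i))"

definition spreading_ca :: "(int ^ 'd) set \<Rightarrow> 'd config \<Rightarrow> 'd config" where
  "spreading_ca N x = (\<lambda>i. if \<exists>j\<in>N. x (i + j) = False then False else True)"

definition noise_matrix :: "real \<Rightarrow> real \<Rightarrow> bool \<Rightarrow> bool \<Rightarrow> real" where
  "noise_matrix p q a b =
     (if a then (if b then 1 - q else q) else (if b then p else 1 - p))"

text \<open>
  Membership in \<open>borel \<rightarrow>\<^sub>M prob_algebra borel\<close> says that \<open>\<Phi>\<close> is a Markov kernel.
\<close>

definition is_PCA ::
    "('d::finite config \<Rightarrow> 'd config) \<Rightarrow> (bool \<Rightarrow> bool \<Rightarrow> real) \<Rightarrow> ('d config \<Rightarrow> 'd config measure) \<Rightarrow> bool" where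
  "is_PCA F \<theta> \<Phi> \<longleftrightarrow>
     \<Phi> \<in> borel \<rightarrow>\<^sub>M prob_algebra borel \<and>
     (\<forall>x K y. finite K \<longrightarrow> measure (\<Phi> x) (cylinder K y) = (\<Prod>k\<in>K. \<theta> (F x k) (y k)))"

primrec kernel_power ::
    "('d::finite config \<Rightarrow> 'd config measure) \<Rightarrow> nat \<Rightarrow> 'd config \<Rightarrow> 'd config measure" where
  "kernel_power \<Phi> 0 x = return borel x"
| "kernel_power \<Phi> (Suc t) x = kernel_power \<Phi> t x \<bind> \<Phi>"

definition invariant_measure ::
    "('d::finite config \<Rightarrow> 'd config measure) \<Rightarrow> 'd config measure \<Rightarrow> bool" where
  "invariant_measure \<Phi> \<pi> \<longleftrightarrow> \<pi> \<in> space (prob_algebra borel) \<and> \<pi> \<bind> \<Phi> = \<pi>"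

definition uniformly_ergodic :: "('d::finite config \<Rightarrow> 'd config measure) \<Rightarrow> bool" where
  "uniformly_ergodic \<Phi> \<longleftrightarrow>
     (\<exists>\<pi>. invariant_measure \<Phi> \<pi> \<and>
          (\<forall>\<pi>'. invariant_measure \<Phi> \<pi>' \<longrightarrow> \<pi>' = \<pi>) \<and>
          (\<forall>K u. finite K \<longrightarrow>
             uniform_limit UNIV (\<lambda>t x. measure (kernel_power \<Phi> t x) (cylinder K u))
               (\<lambda>x. measure \<pi> (cylinder K u)) sequentially))"

text \<open>
  The limit \<open>k \<rightarrow> \<infinity>\<close> is over the lattice points \<open>k \<in> \<int>\<^sup>d\<close> leaving every finite set, i.e. along
  \<^term>\<open>cofinite\<close>.
\<close>

definition spatially_mixing :: "'d::finite config measure \<Rightarrow> bool" where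
  "spatially_mixing \<pi> \<longleftrightarrow>
     (\<forall>K u L v. finite K \<longrightarrow> finite L \<longrightarrow>
        ((\<lambda>k. measure \<pi> (cylinder K u \<inter> shift k -` cylinder L v))
           \<longlongrightarrow> measure \<pi> (cylinder K u) * measure \<pi> (cylinder L v)) cofinite)"


text \<open>Existence and uniqueness of the kernel determined by \<^const>\<open>is_PCA\<close>.\<close>

instance bool :: second_countable_topology
proof
  show "\<exists>B::bool set set. countable B \<and> open = generate_topology B"
  proof (intro exI conjI ext iffI)
    show "countable (UNIV :: bool set set)" by (rule countable_finite) simp
    show "generate_topology UNIV A" for A :: "bool set" by (rule generate_topology.Basis) simp
    show "open A" for A :: "bool set" by (rule discrete_topology_class.open_discrete)
  qed
qed

definition cylinders :: "('d::finite) config set set" where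
  "cylinders = insert {} {cylinder K y | K y. finite K}"

lemma cylinders_Int_stable: "Int_stable (cylinders :: ('d::finite) config set set)"
proof (rule Int_stableI)
  fix A B :: "'d config set" assume AB: "A \<in> cylinders" "B \<in> cylinders"
  show "A \<inter> B \<in> cylinders"
  proof (cases "A \<inter> B = {}")
    case True
    then show ?thesis by (simp add: cylinders_def)
  next
    case False
    then obtain z where z: "z \<in> A" "z \<in> B" by auto
    obtain K y where A: "finite K" "A = cylinder K y" using AB(1) z by (auto simp: cylinders_def)
    obtain L w where B: "finite L" "B = cylinder L w" using AB(2) z by (auto simp: cylinders_def)
    have "A \<inter> B = cylinder (K \<union> L) z"
      using z unfolding A(2) B(2) by (auto simp: cylinder_def)
    moreover have "cylinder (K \<union> L) z \<in> cylinders"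
      using A(1) B(1) by (auto simp: cylinders_def)
    ultimately show ?thesis by simp
  qed
qed

lemma sets_borel_config_PiM:
  "sets (borel :: ('d::finite) config measure) = sets (Pi\<^sub>M UNIV (\<lambda>_. count_space UNIV))"
proof -
  have "sets (borel :: bool measure) = sets (count_space UNIV)"
  proof -
    have "A \<in> sets borel" for A :: "bool set" by (intro borel_open discrete_topology_class.open_discrete)
    then show ?thesis by auto
  qed
  then have "sets (Pi\<^sub>M UNIV (\<lambda>_ :: int ^ 'd. borel :: bool measure))
      = sets (Pi\<^sub>M UNIV (\<lambda>_. count_space UNIV))"
    by (intro sets_PiM_cong) auto
  then show ?thesis by (simp add: sets_PiM_equal_borel)
qed

lemma prod_emb_cylinder:
  assumes "\<And>k. space (M k) = UNIV"
  shows "prod_emb UNIV M K (Pi\<^sub>E K (\<lambda>k. {y k})) = cylinder K (y :: ('d::finite) config)"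
proof (rule set_eqI)
  fix x :: "'d config"
  have "x \<in> prod_emb UNIV M K (Pi\<^sub>E K (\<lambda>k. {y k}))
      \<longleftrightarrow> restrict x K \<in> Pi\<^sub>E K (\<lambda>k. {y k})"
    by (simp only: prod_emb_def assms PiE_UNIV_domain) simp
  also have "\<dots> \<longleftrightarrow> (\<forall>k\<in>K. x k = y k)"
    by (simp only: PiE_def Int_iff restrict_extensional simp_thms Pi_def mem_Collect_eq
        restrict_apply singleton_iff) (simp, blast)
  finally show "x \<in> prod_emb UNIV M K (Pi\<^sub>E K (\<lambda>k. {y k})) \<longleftrightarrow> x \<in> cylinder K y"
    by (simp only: cylinder_def mem_Collect_eq)
qed

lemma cylinder_sets: "finite K \<Longrightarrow> cylinder K y \<in> sets (borel :: ('d::finite) config measure)"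
proof -
  assume K: "finite K"
  have "prod_emb UNIV (\<lambda>_. count_space UNIV) K (Pi\<^sub>E K (\<lambda>k. {y k}))
      \<in> sets (Pi\<^sub>M UNIV (\<lambda>_ :: int ^ 'd. count_space (UNIV :: bool set)))"
    using K by (intro sets_PiM_I) auto
  also have "prod_emb UNIV (\<lambda>_. count_space UNIV) K (Pi\<^sub>E K (\<lambda>k. {y k})) = cylinder K y"
    by (rule prod_emb_cylinder) simp
  finally show ?thesis by (simp add: sets_borel_config_PiM)
qed

lemma sets_borel_cylinders: "sets (borel :: ('d::finite) config measure) = sigma_sets UNIV cylinders"
proof
  show "sigma_sets UNIV cylinders \<subseteq> sets (borel :: 'd config measure)"
  proof -
    have "cylinders \<subseteq> sets (borel :: 'd config measure)"
      by (auto simp: cylinders_def cylinder_sets)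
    then show ?thesis
      using sets.sigma_sets_subset[of cylinders "borel :: 'd config measure"] by simp
  qed
  have gen: "{f. f i \<in> A} \<in> sigma_sets UNIV cylinders" for i :: "int ^ 'd" and A :: "bool set"
  proof -
    interpret sigma_algebra UNIV "sigma_sets UNIV (cylinders :: 'd config set set)"
      by (rule sigma_algebra_sigma_sets) auto
    have "{f. f i \<in> A} = (\<Union>b\<in>A. cylinder {i} (\<lambda>_. b))"
      by (auto simp: cylinder_def)
    also have "\<dots> \<in> sigma_sets UNIV cylinders"
      by (intro finite_UN) (auto intro!: sigma_sets.Basic simp: cylinders_def)
    finally show ?thesis .
  qed
  show "sets (borel :: 'd config measure) \<subseteq> sigma_sets UNIV cylinders"
    unfolding sets_borel_config_PiM sets_PiM_single
    by (simp, rule sigma_sets_mono) (auto simp: gen)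
qed

lemma measure_PiM_cylinder:
  fixes B :: "int ^ 'd::finite \<Rightarrow> bool pmf"
  assumes "finite K"
  shows "measure (Pi\<^sub>M UNIV (\<lambda>k. measure_pmf (B k))) (cylinder K y) = (\<Prod>k\<in>K. measure (B k) {y k})"
proof -
  have "prod_emb UNIV (\<lambda>k. measure_pmf (B k)) K (Pi\<^sub>E K (\<lambda>k. {y k})) = cylinder K y"
    by (rule prod_emb_cylinder) simp
  moreover have "emeasure (Pi\<^sub>M UNIV (\<lambda>k. measure_pmf (B k)))
      (prod_emb UNIV (\<lambda>k. measure_pmf (B k)) K (Pi\<^sub>E K (\<lambda>k. {y k})))
      = (\<Prod>k\<in>K. emeasure (measure_pmf (B k)) {y k})"
    using assms by (intro emeasure_PiM_emb prob_space_measure_pmf) simp_all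
  moreover have "(\<Prod>k\<in>K. emeasure (measure_pmf (B k)) {y k})
      = ennreal (\<Prod>k\<in>K. measure (measure_pmf (B k)) {y k})"
    by (simp add: measure_pmf.emeasure_eq_measure prod_ennreal)
  ultimately show ?thesis by (simp add: measure_def prod_nonneg)
qed

lemma is_PCA_exists:
  fixes F :: "('d::finite) config \<Rightarrow> 'd config"
  assumes \<theta>: "\<And>a b. 0 \<le> \<theta> a b" "\<And>a. \<theta> a False + \<theta> a True = 1"
    and F: "F \<in> borel \<rightarrow>\<^sub>M borel"
  shows "\<exists>\<Phi>. is_PCA F \<theta> \<Phi>"
proof -
  define M where "M x k = measure_pmf (bernoulli_pmf (\<theta> (F x k) True))" for x :: "'d config" and k
  define \<Phi> where "\<Phi> x = Pi\<^sub>M UNIV (M x)" for x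
  have le1: "\<theta> a True \<le> 1" for a using \<theta>(1)[of a False] \<theta>(2)[of a] by linarith
  have setsM: "sets (\<Phi> x) = sets borel" for x
    unfolding \<Phi>_def sets_borel_config_PiM by (intro sets_PiM_cong) (auto simp: M_def)
  have pr: "prob_space (\<Phi> x)" for x
    unfolding \<Phi>_def by (intro prob_space_PiM) (simp add: M_def prob_space_measure_pmf)
  have cyl: "measure (\<Phi> x) (cylinder K y) = (\<Prod>k\<in>K. \<theta> (F x k) (y k))" if K: "finite K" for x K y
  proof -
    have "measure (\<Phi> x) (cylinder K y) = (\<Prod>k\<in>K. measure (M x k) {y k})"
      unfolding \<Phi>_def M_def by (rule measure_PiM_cylinder[OF K])
    also have "\<dots> = (\<Prod>k\<in>K. \<theta> (F x k) (y k))"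
    proof (rule prod.cong)
      fix k
      have "\<theta> a False = 1 - \<theta> a True" for a using \<theta>(2)[of a] by linarith
      then show "measure (M x k) {y k} = \<theta> (F x k) (y k)"
        using \<theta>(1) le1 by (cases "y k") (simp_all add: M_def measure_pmf_single)
    qed simp
    finally show ?thesis .
  qed
  have meas: "\<Phi> \<in> borel \<rightarrow>\<^sub>M prob_algebra borel"
  proof (rule measurable_prob_algebra_generated[OF sets_borel_cylinders cylinders_Int_stable])
    fix A :: "'d config set" assume "A \<in> cylinders"
    then consider "A = {}" | K y where "finite K" "A = cylinder K y" by (auto simp: cylinders_def)
    then show "(\<lambda>x. emeasure (\<Phi> x) A) \<in> borel_measurable borel"
    proof cases
      case 2
      have "(\<lambda>x. \<theta> (F x k) (y k)) \<in> borel_measurable borel" for k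
      proof -
        have "(\<lambda>x :: 'd config. x k) \<in> borel \<rightarrow>\<^sub>M count_space UNIV"
          using measurable_component_singleton[of k UNIV "\<lambda>_. count_space (UNIV :: bool set)"]
          by (simp add: measurable_cong_sets[OF sets_borel_config_PiM refl])
        then have "(\<lambda>x. F x k) \<in> borel \<rightarrow>\<^sub>M count_space UNIV"
          by (rule measurable_compose[OF F])
        then show ?thesis by (rule measurable_compose) simp
      qed
      then have "(\<lambda>x. ennreal (\<Prod>k\<in>K. \<theta> (F x k) (y k))) \<in> borel_measurable borel"
        by measurable
      moreover have "emeasure (\<Phi> x) A = ennreal (\<Prod>k\<in>K. \<theta> (F x k) (y k))" for x
        using cyl[OF 2(1)] 2(2) finite_measure.emeasure_eq_measure[OF prob_space.axioms(1)[OF pr]]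
        by simp
      ultimately show ?thesis by simp
    qed simp
  qed (auto simp: pr setsM)
  show ?thesis
    using meas cyl unfolding is_PCA_def by blast
qed

lemma spreading_ca_measurable:
  fixes N :: "(int ^ 'd::finite) set"
  assumes "finite N"
  shows "spreading_ca N \<in> borel \<rightarrow>\<^sub>M borel"
proof -
  have comp: "(\<lambda>x :: 'd config. x k) \<in> borel \<rightarrow>\<^sub>M count_space UNIV" for k
    using measurable_component_singleton[of k UNIV "\<lambda>_. count_space (UNIV :: bool set)"]
    by (simp add: measurable_cong_sets[OF sets_borel_config_PiM refl])
  have "spreading_ca N \<in> borel \<rightarrow>\<^sub>M Pi\<^sub>M UNIV (\<lambda>_. count_space UNIV)"
  proof (rule measurable_PiM_single')
    fix i :: "int ^ 'd"
    have "(\<lambda>x :: 'd config. \<forall>j\<in>N. x (i + j)) \<in> borel \<rightarrow>\<^sub>M count_space UNIV"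
      using assms comp by (intro pred_intros_finite) auto
    then show "(\<lambda>x. spreading_ca N x i) \<in> borel \<rightarrow>\<^sub>M count_space UNIV"
      by (simp add: spreading_ca_def)
  qed simp
  then show ?thesis by (simp add: measurable_cong_sets[OF refl sets_borel_config_PiM])
qed

corollary spreading_PCA_exists:
  assumes "finite N" "p \<in> {0..1}" "q \<in> {0..1}"
  shows "\<exists>\<Phi>. is_PCA (spreading_ca N) (noise_matrix p q) \<Phi>"
  using assms by (intro is_PCA_exists spreading_ca_measurable) (auto simp: noise_matrix_def)

lemma is_PCA_unique:
  assumes "is_PCA F \<theta> \<Phi>" "is_PCA F \<theta> \<Phi>'"
  shows "\<Phi> = (\<Phi>' :: ('d::finite) config \<Rightarrow> _)"
proof
  fix x :: "'d config"
  have *: "prob_space (\<Psi> x) \<and> sets (\<Psi> x) = sets borel" if "is_PCA F \<theta> \<Psi>" for \<Psi>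
    using that measurable_space[of \<Psi> borel "prob_algebra borel" x]
    by (auto simp: is_PCA_def space_prob_algebra)
  note P = *[OF assms(1)] *[OF assms(2)]
  have fin: "finite_measure (\<Phi> x)" "finite_measure (\<Phi>' x)"
    using P by (auto intro: prob_space.axioms(1))
  show "\<Phi> x = \<Phi>' x"
  proof (rule measure_eqI_generator_eq[OF cylinders_Int_stable, of UNIV _ _ "\<lambda>_. UNIV"])
    have "UNIV = cylinder {} (\<lambda>_. False)" by (simp add: cylinder_def)
    then show "range (\<lambda>_ :: nat. UNIV) \<subseteq> (cylinders :: 'd config set set)"
      by (auto simp: cylinders_def)
    show "emeasure (\<Phi> x) A = emeasure (\<Phi>' x) A" if "A \<in> cylinders" for A
      using that assms fin
      by (auto simp: cylinders_def is_PCA_def finite_measure.emeasure_eq_measure)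
    show "emeasure (\<Phi> x) UNIV \<noteq> \<infinity>" using fin(1) by (simp add: finite_measure.emeasure_finite)
  qed (use P in \<open>auto simp: sets_borel_cylinders\<close>)
qed

end

theory Submission
  imports Defs
begin

text \<open>
  Write \<open>f\<^sub>A\<close> for the indicator of the configurations equal to \<open>1\<close> on \<open>A\<close> and put \<open>r = 1 - p - q\<close>.  Since
  \<open>(F x)\<^sub>a = 1\<close> exactly if \<open>x\<close> is \<open>1\<close> on \<open>a + N\<close>, expanding the product
  \<open>\<Phi> f\<^sub>A = \<Prod>\<^sub>a (p + r f\<^sub>a\<^sub>+\<^sub>N)\<close> gives the duality
  \<open>\<Phi> f\<^sub>A = \<Sum>\<^sub>B\<^sub>\<subseteq>\<^sub>A r\<^bsup>|B|\<^esup> p\<^bsup>|A-B|\<^esup> f\<^sub>B\<^sub>+\<^sub>N\<close>.  The absolute values of the coefficients sum to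
  \<open>(p + |r|)\<^bsup>|A|\<^esup>\<close>, so \<open>\<Phi>\<^sup>t f\<^sub>A\<close> oscillates by at most \<open>(p + |r|)\<^sup>t\<close>, and the \<open>f\<^sub>A\<close> span the
  cylinder functions.  For mixing, \<open>\<Phi>\<^sup>t f\<^sub>A\<^sub>\<union>\<^sub>C\<close> at the all-ones configuration factorises as soon as the
  sets \<open>A\<close> and \<open>C\<close>, enlarged by fewer than \<open>t\<close> copies of \<open>N\<close>, are disjoint, and it is invariant under
  translation.
\<close>

section \<open>All-ones cylinders\<close>

abbreviation ones :: "(int ^ 'd::finite) set \<Rightarrow> 'd config set" where
  "ones A \<equiv> cylinder A (\<lambda>_. True)"

text \<open>Inclusion-exclusion as an induction rule: a prescribed zero at \<open>b\<close> is
  removed by subtracting the cylinder with a one at \<open>b\<close> from the one that leaves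
  \<open>b\<close> free. Measures, limits and uniform limits all respect such proper
  differences.\<close>

lemma cylinder_induct_ones [consumes 1, case_names ones Diff]:
  fixes P :: "'d::finite config set \<Rightarrow> bool"
  assumes "finite K"
    and ones: "\<And>A. finite A \<Longrightarrow> P (ones A)"
    and Diff: "\<And>S T. S \<in> sets borel \<Longrightarrow> T \<in> sets borel \<Longrightarrow> T \<subseteq> S \<Longrightarrow> P S \<Longrightarrow> P T \<Longrightarrow> P (S - T)"
  shows "P (cylinder K y)"
proof -
  \<comment> \<open>Ones on \<open>A\<close>, zeros on \<open>B\<close>. The induction on
    \<open>B\<close> keeps \<open>A\<close> arbitrary because the removed site \<open>b\<close> may
    move into \<open>A\<close>.\<close>
  let ?E = "\<lambda>A B. cylinder (A \<union> B) (\<lambda>k. k \<notin> B) :: 'd config set"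
  have step: "P (?E A B)" if "finite B" "finite A" "A \<inter> B = {}" for A B
    using that
  proof (induction B arbitrary: A)
    case empty
    then show ?case by (simp add: ones)
  next
    case (insert b B)
    have "?E A (insert b B) = ?E A B - ?E (insert b A) B"
      using insert.prems insert.hyps by (auto simp: cylinder_def)
    moreover have "P (?E A B - ?E (insert b A) B)"
    proof (rule Diff)
      show "?E (insert b A) B \<subseteq> ?E A B" by (auto simp: cylinder_def)
      show "P (?E A B)" "P (?E (insert b A) B)"
        using insert.prems insert.hyps insert.IH[of A] insert.IH[of "insert b A"] by auto
    qed (use insert.prems insert.hyps in \<open>auto intro!: cylinder_sets\<close>)
    ultimately show ?case by simp
  qed
  have "cylinder K y = ?E {k \<in> K. y k} {k \<in> K. \<not> y k}"
    by (auto simp: cylinder_def)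
  then show ?thesis
    using step[of "{k \<in> K. \<not> y k}" "{k \<in> K. y k}"] \<open>finite K\<close> by auto
qed

text \<open>Proper differences carry the agreement to all cylinders, which form an
  intersection-stable generator of the Borel sets.\<close>

lemma prob_measure_eqI_ones:
  fixes \<mu> \<nu> :: "'d::finite config measure"
  assumes "\<mu> \<in> space (prob_algebra borel)" "\<nu> \<in> space (prob_algebra borel)"
    and eq: "\<And>A. finite A \<Longrightarrow> measure \<mu> (ones A) = measure \<nu> (ones A)"
  shows "\<mu> = \<nu>"
proof -
  have pr: "prob_space \<mu>" "prob_space \<nu>" and sets: "sets \<mu> = sets borel" "sets \<nu> = sets borel"
    using assms by (auto simp: space_prob_algebra)
  interpret \<mu>: prob_space \<mu> by fact
  interpret \<nu>: prob_space \<nu> by fact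
  have cyl: "measure \<mu> (cylinder K y) = measure \<nu> (cylinder K y)" if "finite K" for K y
    using that
    by (induction rule: cylinder_induct_ones)
      (simp_all add: eq \<mu>.finite_measure_Diff \<nu>.finite_measure_Diff sets)
  show ?thesis
  proof (rule measure_eqI_generator_eq[OF cylinders_Int_stable, of UNIV _ _ "\<lambda>_. UNIV"])
    have "UNIV = ones {}" by (simp add: cylinder_def)
    then show "range (\<lambda>_ :: nat. UNIV) \<subseteq> (cylinders :: 'd config set set)"
      by (auto simp: cylinders_def)
    show "emeasure \<mu> S = emeasure \<nu> S" if "S \<in> cylinders" for S
      using that cyl by (auto simp: cylinders_def \<mu>.emeasure_eq_measure \<nu>.emeasure_eq_measure)
  qed (auto simp: sets sets_borel_cylinders)
qed

section \<open>Limits of measures on the configuration space\<close>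

text \<open>These are the events depending on finitely many coordinates, the clopen sets. Unlike the
  cylinders they form an algebra, the domain needed for a Caratheodory extension.\<close>

definition local_sets :: "'d::finite config set set" where
  "local_sets = {S. \<exists>K. finite K \<and> (\<forall>x\<in>S. cylinder K x \<subseteq> S)}"

text \<open>Coding a pattern on \<open>K\<close> by the set \<open>B\<close> of its ones makes the
  patterns in \<open>S\<close> a finite index set, and distinct patterns on the same window exclude
  each other.\<close>

lemma local_sets_eq_Union_cylinders:
  fixes S :: "'d::finite config set"
  assumes "S \<in> local_sets"
  obtains K where "finite K"
    "S = (\<Union>B\<in>{B \<in> Pow K. (\<lambda>k. k \<in> B) \<in> S}. cylinder K (\<lambda>k. k \<in> B))"
    "disjoint_family_on (\<lambda>B. cylinder K (\<lambda>k. k \<in> B)) {B \<in> Pow K. (\<lambda>k. k \<in> B) \<in> S}"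
proof -
  obtain K where K: "finite K" "\<And>x. x \<in> S \<Longrightarrow> cylinder K x \<subseteq> S"
    using assms by (auto simp: local_sets_def)
  have "x \<in> (\<Union>B\<in>{B \<in> Pow K. (\<lambda>k. k \<in> B) \<in> S}. cylinder K (\<lambda>k. k \<in> B))" if "x \<in> S" for x
  proof -
    let ?B = "{k \<in> K. x k}"
    have "(\<lambda>k. k \<in> ?B) \<in> cylinder K x" "x \<in> cylinder K (\<lambda>k. k \<in> ?B)"
      by (auto simp: cylinder_def)
    then show ?thesis using K(2)[OF that] by (intro UN_I[of ?B]) auto
  qed
  then have eq: "S = (\<Union>B\<in>{B \<in> Pow K. (\<lambda>k. k \<in> B) \<in> S}. cylinder K (\<lambda>k. k \<in> B))"
    using K(2) by blast
  have "B = B'" if "B \<subseteq> K" "B' \<subseteq> K" "x \<in> cylinder K (\<lambda>k. k \<in> B)" "x \<in> cylinder K (\<lambda>k. k \<in> B')"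
    for B B' x
    using that by (auto simp: cylinder_def)
  then have "disjoint_family_on (\<lambda>B. cylinder K (\<lambda>k. k \<in> B)) {B \<in> Pow K. (\<lambda>k. k \<in> B) \<in> S}"
    unfolding disjoint_family_on_def by blast
  with K(1) eq show ?thesis by (rule that)
qed

lemma algebra_local_sets: "algebra UNIV (local_sets :: 'd::finite config set set)"
  unfolding algebra_iff_Un
proof (intro conjI ballI)
  fix S T :: "'d config set" assume S: "S \<in> local_sets" and T: "T \<in> local_sets"
  obtain K L where "finite K" "\<And>x. x \<in> S \<Longrightarrow> cylinder K x \<subseteq> S"
    and "finite L" "\<And>x. x \<in> T \<Longrightarrow> cylinder L x \<subseteq> T"
    using S T by (auto simp: local_sets_def)
  moreover have "cylinder (K \<union> L) x \<subseteq> cylinder K x \<inter> cylinder L x" for x :: "'d config"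
    by (auto simp: cylinder_def)
  ultimately have "finite (K \<union> L)" "\<forall>x\<in>S \<union> T. cylinder (K \<union> L) x \<subseteq> S \<union> T"
    by blast+
  then show "S \<union> T \<in> local_sets" unfolding local_sets_def by blast
next
  fix S :: "'d config set" assume S: "S \<in> local_sets"
  then obtain K where K: "finite K" "\<And>x. x \<in> S \<Longrightarrow> cylinder K x \<subseteq> S"
    by (auto simp: local_sets_def)
  have "x \<in> cylinder K z" if "z \<in> cylinder K x" for x z :: "'d config"
    using that by (auto simp: cylinder_def)
  then have "\<forall>x\<in>UNIV - S. cylinder K x \<subseteq> UNIV - S"
    using K(2) by blast
  then show "UNIV - S \<in> local_sets" using K(1) unfolding local_sets_def by blast
qed (auto simp: local_sets_def)

lemma cylinder_in_local_sets: "finite K \<Longrightarrow> cylinder K y \<in> local_sets"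
  by (auto simp: local_sets_def cylinder_def intro!: exI[of _ K])

lemma local_sets_subset_borel: "local_sets \<subseteq> sets (borel :: 'd::finite config measure)"
proof
  fix S :: "'d config set" assume "S \<in> local_sets"
  then show "S \<in> sets borel"
  proof (rule local_sets_eq_Union_cylinders)
    fix K
    assume K: "finite K" and S: "S = (\<Union>B\<in>{B \<in> Pow K. (\<lambda>k. k \<in> B) \<in> S}. cylinder K (\<lambda>k. k \<in> B))"
    show "S \<in> sets borel"
      by (subst S) (use K in \<open>intro sets.finite_UN cylinder_sets, auto\<close>)
  qed
qed

lemma sets_borel_local_sets: "sets (borel :: 'd::finite config measure) = sigma_sets UNIV local_sets"
proof
  show "sets (borel :: 'd config measure) \<subseteq> sigma_sets UNIV local_sets"
    unfolding sets_borel_cylinders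
  proof (rule sigma_sets_subseteq)
    have "{} \<in> (local_sets :: 'd config set set)" by (auto simp: local_sets_def)
    then show "cylinders \<subseteq> (local_sets :: 'd config set set)"
      by (auto simp: cylinders_def cylinder_in_local_sets)
  qed
  show "sigma_sets UNIV local_sets \<subseteq> sets (borel :: 'd config measure)"
    using sets.sigma_sets_subset[OF local_sets_subset_borel] by simp
qed

lemma closed_local_sets:
  fixes S :: "'d::finite config set"
  assumes "S \<in> local_sets"
  shows "closed S"
proof -
  obtain K where K: "finite K" "\<And>x. x \<in> UNIV - S \<Longrightarrow> cylinder K x \<subseteq> UNIV - S"
  proof -
    have "UNIV - S \<in> local_sets"
      using algebra_local_sets assms unfolding algebra_iff_Un by blast
    then show ?thesis using that by (auto simp: local_sets_def)
  qed
  have op: "open (cylinder K x)" for x :: "'d config"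
  proof -
    have "cylinder K x = (\<Inter>k\<in>K. (\<lambda>z. z k) -` {x k})"
      by (auto simp: cylinder_def)
    also have "open \<dots>"
      using K(1) by (intro open_INT ballI open_vimage) (auto intro: discrete_topology_class.open_discrete)
    finally show ?thesis .
  qed
  have "x \<in> cylinder K x" for x :: "'d config" by (simp add: cylinder_def)
  with K(2) have "UNIV - S = (\<Union>x\<in>UNIV - S. cylinder K x)" by blast
  then have "open (UNIV - S)" using op by (metis open_UN)
  then show ?thesis by (simp add: closed_def Compl_eq_Diff_UNIV)
qed

lemma compact_UNIV_config: "compact (UNIV :: 'd::finite config set)"
proof -
  have "compact_space (euclidean :: bool topology)"
    by (simp add: compact_space_def finite_imp_compact)
  then have "compact_space (product_topology (\<lambda>_ :: int ^ 'd. euclidean :: bool topology) UNIV)"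
    by (simp add: compact_space_product_topology)
  then show ?thesis
    by (simp add: euclidean_product_topology compact_space_def)
qed

text \<open>Cantor's intersection theorem: local sets are closed and the configuration space is
  compact, so nonempty decreasing ones would have a common point.\<close>

lemma decseq_local_sets_eventually_empty:
  fixes A :: "nat \<Rightarrow> 'd::finite config set"
  assumes "range A \<subseteq> local_sets" "decseq A" "(\<Inter>i. A i) = {}"
  shows "\<forall>\<^sub>F i in sequentially. A i = {}"
proof -
  have "\<exists>n. A n = {}"
  proof (rule ccontr)
    assume ne: "\<nexists>n. A n = {}"
    have "UNIV \<inter> \<Inter>(range A) \<noteq> {}"
    proof (rule compact_imp_fip[OF compact_UNIV_config])
      fix F assume F: "finite F" "F \<subseteq> range A"
      then obtain I where I: "finite I" "F = A ` I" by (meson finite_subset_image)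
      obtain n where "\<forall>i\<in>I. i \<le> n" using I(1) finite_nat_set_iff_bounded_le by blast
      \<comment> \<open>A finite subfamily of a decreasing sequence is bounded below by one late
        member, which is nonempty.\<close>
      then have "A n \<subseteq> \<Inter>F" using \<open>decseq A\<close> I(2) by (auto simp: decseq_def)
      then show "UNIV \<inter> \<Inter>F \<noteq> {}" using ne by auto
    qed (use assms closed_local_sets in blast)
    then show False using assms by simp
  qed
  then obtain n where "A n = {}" ..
  then have "A i = {}" if "i \<ge> n" for i
    using \<open>decseq A\<close> that unfolding decseq_def by blast
  then show ?thesis by (auto simp: eventually_sequentially)
qed

text \<open>
  Finite additivity is preserved by limits on local sets, and compactness upgrades it to
  \<open>\<sigma>\<close>-additivity.
\<close>

lemma limit_measure_exists:
  fixes M :: "nat \<Rightarrow> 'd::finite config measure"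
  assumes M: "\<And>t. M t \<in> space (prob_algebra borel)"
    and conv: "\<And>A. finite A \<Longrightarrow> convergent (\<lambda>t. measure (M t) (ones A))"
  shows "\<exists>\<pi>\<in>space (prob_algebra borel). \<forall>A. finite A \<longrightarrow>
           (\<lambda>t. measure (M t) (ones A)) \<longlonglongrightarrow> measure \<pi> (ones A)"
proof -
  have pr: "prob_space (M t)" and sets: "sets (M t) = sets borel" for t
    using M[of t] by (auto simp: space_prob_algebra)
  have fm: "finite_measure (M t)" for t using pr by (rule prob_space.axioms(1))
  have conv_cyl: "convergent (\<lambda>t. measure (M t) (cylinder K y))" if "finite K" for K y
    using that
    by (induction rule: cylinder_induct_ones)
      (simp_all add: conv finite_measure.finite_measure_Diff[OF fm] sets convergent_diff)
  have conv_local: "convergent (\<lambda>t. measure (M t) S)" if S: "S \<in> local_sets" for S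
    using S
  proof (rule local_sets_eq_Union_cylinders)
    fix K let ?\<B> = "{B \<in> Pow K. (\<lambda>k. k \<in> B) \<in> S}"
    assume K: "finite K" and S: "S = (\<Union>B\<in>?\<B>. cylinder K (\<lambda>k. k \<in> B))"
      and disj: "disjoint_family_on (\<lambda>B. cylinder K (\<lambda>k. k \<in> B)) ?\<B>"
    have "measure (M t) S = (\<Sum>B\<in>?\<B>. measure (M t) (cylinder K (\<lambda>k. k \<in> B)))" for t
      by (subst S, rule finite_measure.finite_measure_finite_Union[OF fm _ _ disj])
        (use K in \<open>auto simp: sets cylinder_sets\<close>)
    then show ?thesis
      using K conv_cyl by (simp add: convergent_sum)
  qed
  \<comment> \<open>The limit is meaningful on local sets only, so every fact about \<open>m\<close>
    is restricted to them.\<close>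
  define m where "m S = lim (\<lambda>t. measure (M t) S)" for S
  have m: "(\<lambda>t. measure (M t) S) \<longlonglongrightarrow> m S" if "S \<in> local_sets" for S
    using conv_local[OF that] by (simp add: m_def convergent_LIMSEQ_iff)
  have m_nonneg: "0 \<le> m S" if "S \<in> local_sets" for S
    using m[OF that] by (rule LIMSEQ_le_const) simp
  interpret algebra "UNIV :: 'd config set" local_sets by (rule algebra_local_sets)
  have m_empty: "m {} = 0" by (simp add: m_def)
  have m_add: "m (S \<union> T) = m S + m T" if "S \<in> local_sets" "T \<in> local_sets" "S \<inter> T = {}" for S T
  proof (rule LIMSEQ_unique)
    show "(\<lambda>t. measure (M t) (S \<union> T)) \<longlonglongrightarrow> m (S \<union> T)" using that by (intro m Un)
    have "measure (M t) (S \<union> T) = measure (M t) S + measure (M t) T" for t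
      using that local_sets_subset_borel sets
      by (intro finite_measure.finite_measure_Union[OF fm]) blast+
    then show "(\<lambda>t. measure (M t) (S \<union> T)) \<longlonglongrightarrow> m S + m T"
      using that by (simp add: tendsto_add m)
  qed
  have "\<exists>\<mu> :: 'd config set \<Rightarrow> ennreal. (\<forall>S\<in>local_sets. \<mu> S = ennreal (m S)) \<and>
          measure_space UNIV (sigma_sets UNIV local_sets) \<mu>"
  proof (rule caratheodory_empty_continuous)
    show "positive local_sets (\<lambda>S. ennreal (m S))"
      by (simp add: positive_def m_empty)
    show "additive local_sets (\<lambda>S. ennreal (m S))"
      by (auto simp: additive_def m_add m_nonneg)
    \<comment> \<open>Continuity at the empty set is immediate: by compactness the sequence of sets
      is eventually empty.\<close>
    show "(\<lambda>i. ennreal (m (A i))) \<longlonglongrightarrow> 0"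
      if "range A \<subseteq> local_sets" "decseq A" "(\<Inter>i. A i) = {}" for A
      using decseq_local_sets_eventually_empty[OF that]
      by (intro tendsto_eventually) (auto elim!: eventually_mono simp: m_empty)
  qed simp
  then obtain \<mu> :: "'d config set \<Rightarrow> ennreal" where \<mu>: "\<And>S. S \<in> local_sets \<Longrightarrow> \<mu> S = ennreal (m S)"
    and ms: "measure_space UNIV (sets (borel :: 'd config measure)) \<mu>"
    unfolding sets_borel_local_sets by blast
  define \<pi> where "\<pi> = measure_of UNIV (sets (borel :: 'd config measure)) \<mu>"
  have sets_\<pi>: "sets \<pi> = sets borel" and space_\<pi>: "space \<pi> = UNIV"
    unfolding \<pi>_def using sets.sigma_sets_eq[of "borel :: 'd config measure"] by simp_all
  have em: "emeasure \<pi> S = \<mu> S" if "S \<in> sets borel" for S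
    unfolding \<pi>_def using ms that
    by (intro emeasure_measure_of_sigma) (auto simp: measure_space_def)
  have local_\<pi>: "measure \<pi> S = m S" if "S \<in> local_sets" for S
  proof -
    have "emeasure \<pi> S = ennreal (m S)"
      using em[OF subsetD[OF local_sets_subset_borel that]] \<mu>[OF that] by (rule trans)
    then show ?thesis using m_nonneg[OF that] by (simp add: measure_def)
  qed
  \<comment> \<open>The whole space is itself a local set, so no mass is lost in the limit.\<close>
  have "m UNIV = 1"
  proof (rule LIMSEQ_unique)
    show "(\<lambda>t. measure (M t) UNIV) \<longlonglongrightarrow> m UNIV" by (intro m top)
    have "measure (M t) UNIV = 1" for t
      using prob_space.prob_space[OF pr[of t]] sets_eq_imp_space_eq[OF sets[of t]] by simp
    then show "(\<lambda>t. measure (M t) UNIV) \<longlonglongrightarrow> 1" by simp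
  qed
  then have "prob_space \<pi>"
    using em[of UNIV] \<mu>[OF top] by (intro prob_spaceI) (simp add: space_\<pi>)
  then have "\<pi> \<in> space (prob_algebra borel)"
    by (simp add: space_prob_algebra sets_\<pi>)
  then show ?thesis
    by (intro bexI[of _ \<pi>]) (simp_all add: local_\<pi> m cylinder_in_local_sets)
qed

section \<open>The dual process started from the all-ones configuration\<close>

text \<open>The total weight after \<open>t\<close> steps of a signed set-valued process run
  backwards in time: each site of \<open>A\<close> is deleted with weight \<open>p\<close> or kept
  with weight \<open>r\<close>, and the kept set \<open>B\<close> spreads to \<open>B + N\<close>.
  The initial value 1 is the value of every all-ones indicator at the all-ones
  configuration.\<close>

primrec dual_weight :: "'a::ab_group_add set \<Rightarrow> real \<Rightarrow> real \<Rightarrow> nat \<Rightarrow> 'a set \<Rightarrow> real" where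
  "dual_weight N p r 0 A = 1"
| "dual_weight N p r (Suc t) A =
     (\<Sum>B\<in>Pow A. r ^ card B * p ^ card (A - B) * dual_weight N p r t (B + N))"

text \<open>Translation commutes with taking subsets and adding \<open>N\<close>, and preserves
  cardinalities. The translation invariance needed for mixing enters through this identity.\<close>

lemma dual_weight_translate: "dual_weight N p r t ((+) k ` A) = dual_weight N p r t A"
proof (induction t arbitrary: A)
  case (Suc t)
  have inj: "inj_on ((+) k) X" for X by simp
  have img: "inj_on ((`) ((+) k)) (Pow A)" by (simp add: inj_on_image_Pow)
  have "(+) k ` B + N = (+) k ` (B + N)" for B
    by (force simp: set_plus_def add.assoc)
  then show ?case
    by (simp add: image_Pow_surj[OF refl, symmetric] sum.reindex[OF img] card_image
        image_set_diff[OF inj, symmetric] Suc)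
qed simp

text \<open>As long as the two dual processes cannot meet, a subset of \<open>A \<union> C\<close>
  splits uniquely into independent choices in \<open>A\<close> and \<open>C\<close>, and the weights
  multiply. Times \<open>s < t\<close> suffice because the weight at the last time is 1 for every
  set.\<close>

lemma dual_weight_Un:
  assumes "finite A" "finite C" "finite N"
    and "\<And>s. s < t \<Longrightarrow> (A + (\<Sum>i<s. N)) \<inter> (C + (\<Sum>i<s. N)) = {}"
  shows "dual_weight N p r t (A \<union> C) = dual_weight N p r t A * dual_weight N p r t C"
  using assms
proof (induction t arbitrary: A C)
  case (Suc t)
  let ?w = "dual_weight N p r t" and ?c = "\<lambda>A B. r ^ card B * p ^ card (A - B)"
  \<comment> \<open>The empty Minkowski sum is the zero set \<open>{0}\<close>, so the case
    \<open>s = 0\<close> is disjointness of \<open>A\<close> and \<open>C\<close>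
    themselves.\<close>
  have disj: "A \<inter> C = {}" using Suc.prems(4)[of 0] by simp
  have summand: "?c (A \<union> C) (B \<union> D) * ?w ((B \<union> D) + N) = (?c A B * ?w (B + N)) * (?c C D * ?w (D + N))"
    if BD: "B \<subseteq> A" "D \<subseteq> C" for B D
  proof -
    have fin: "finite B" "finite D"
      using BD Suc.prems(1,2) by (auto intro: finite_subset)
    have "(B + N + (\<Sum>i<s. N)) \<inter> (D + N + (\<Sum>i<s. N)) = {}" if "s < t" for s
    proof -
      \<comment> \<open>The \<open>s\<close>-fold enlargement of \<open>B + N\<close> lies in the
        \<open>(s + 1)\<close>-fold enlargement of \<open>A\<close>, so the hypothesis is passed on
        with its index shifted by one.\<close>
      have "X + N + (\<Sum>i<s. N) \<subseteq> Y + (\<Sum>i<Suc s. N)" if "X \<subseteq> Y" for X Y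
        using that by (simp add: add.assoc add.commute[of N] set_plus_mono2)
      then show ?thesis using Suc.prems(4)[of "Suc s"] BD \<open>s < t\<close> by blast
    qed
    then have "?w ((B \<union> D) + N) = ?w (B + N) * ?w (D + N)"
      using fin Suc.prems(3) by (simp add: Un_set_plus Suc.IH finite_set_plus)
    moreover have "card (B \<union> D) = card B + card D"
      using fin BD disj by (intro card_Un_disjoint) auto
    moreover have "card ((A \<union> C) - (B \<union> D)) = card (A - B) + card (C - D)"
    proof -
      have "(A \<union> C) - (B \<union> D) = (A - B) \<union> (C - D)" using BD disj by blast
      then show ?thesis using Suc.prems disj by (simp add: card_Un_disjoint Int_Diff_disjoint disjoint_iff)
    qed
    ultimately show ?thesis by (simp add: power_add)
  qed
  have "dual_weight N p r (Suc t) (A \<union> C)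
      = (\<Sum>(B, D)\<in>Pow A \<times> Pow C. ?c (A \<union> C) (B \<union> D) * ?w ((B \<union> D) + N))"
    unfolding dual_weight.simps
    by (rule sum.reindex_bij_witness[of _ "\<lambda>(B, D). B \<union> D" "\<lambda>X. (X \<inter> A, X \<inter> C)"])
      (use disj in \<open>auto simp: Int_absorb2 simp flip: Int_Un_distrib\<close>)
  also have "\<dots> = (\<Sum>(B, D)\<in>Pow A \<times> Pow C. (?c A B * ?w (B + N)) * (?c C D * ?w (D + N)))"
    by (intro sum.cong refl) (use summand in auto)
  also have "\<dots> = dual_weight N p r (Suc t) A * dual_weight N p r (Suc t) C"
    by (simp add: sum_product sum.cartesian_product)
  finally show ?case .
qed simp

section \<open>Duality and contraction\<close>

lemma spreading_ca_eq: "spreading_ca N x a \<longleftrightarrow> x \<in> ones ((+) a ` N)"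
  by (auto simp: spreading_ca_def cylinder_def)

lemma kernel_power_eq_funpow: "kernel_power \<Phi> t x = ((\<lambda>\<nu>. \<nu> \<bind> \<Phi>) ^^ t) (return borel x)"
  by (induction t) simp_all

lemma invariant_funpow:
  "invariant_measure \<Phi> \<pi> \<Longrightarrow> ((\<lambda>\<nu>. \<nu> \<bind> \<Phi>) ^^ t) \<pi> = \<pi>"
  by (induction t) (simp_all add: invariant_measure_def)

context
  fixes N :: "(int ^ 'd::finite) set" and p q :: real and \<Phi> :: "'d config \<Rightarrow> 'd config measure"
  assumes finN: "finite N" and p01: "p \<in> {0..1}" and q01: "q \<in> {0..1}"
    and PCA: "is_PCA (spreading_ca N) (noise_matrix p q) \<Phi>"
    and contr: "p + \<bar>1 - p - q\<bar> < 1"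
begin

private abbreviation (input) "evolve t \<nu> \<equiv> ((\<lambda>\<nu>. \<nu> \<bind> \<Phi>) ^^ t) \<nu>"

private abbreviation (input) "rate \<equiv> p + \<bar>1 - p - q\<bar>"

lemma kernel_ones:
  assumes "finite A"
  shows "measure (\<Phi> x) (ones A) =
    (\<Sum>B\<in>Pow A. (1 - p - q) ^ card B * p ^ card (A - B) * indicator (ones (B + N)) x)"
proof -
  have "measure (\<Phi> x) (ones A) = (\<Prod>a\<in>A. noise_matrix p q (spreading_ca N x a) True)"
    using PCA assms by (simp add: is_PCA_def)
  \<comment> \<open>The column \<open>True\<close> of the noise matrix is affine in the indicator:
    \<open>p\<close> at zero and \<open>1 - q = (1 - p - q) + p\<close> at one.\<close>
  also have "\<dots> = (\<Prod>a\<in>A. (1 - p - q) * indicator (ones ((+) a ` N)) x + p)"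
    by (intro prod.cong refl) (simp add: noise_matrix_def spreading_ca_eq)
  also have "\<dots> = (\<Sum>B\<in>Pow A. (\<Prod>a\<in>B. (1 - p - q) * indicator (ones ((+) a ` N)) x) * p ^ card (A - B))"
    using assms by (simp add: prod_add)
  also have "\<dots> = (\<Sum>B\<in>Pow A. (1 - p - q) ^ card B * p ^ card (A - B) * indicator (ones (B + N)) x)"
  proof (intro sum.cong refl)
    fix B assume "B \<in> Pow A"
    then have B: "finite B" using assms finite_subset by auto
    have "(\<Prod>a\<in>B. indicator (ones ((+) a ` N)) x) = (indicator (ones (B + N)) x :: real)"
    proof (cases "x \<in> ones (B + N)")
      case True
      then have "\<forall>a\<in>B. x \<in> ones ((+) a ` N)" by (auto simp: cylinder_def)
      with True show ?thesis by simp
    next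
      case False
      then have "\<exists>a\<in>B. x \<notin> ones ((+) a ` N)" by (auto simp: cylinder_def set_plus_def)
      with False B show ?thesis by (auto simp: indicator_eq_0_iff)
    qed
    then show "(\<Prod>a\<in>B. (1 - p - q) * indicator (ones ((+) a ` N)) x) * p ^ card (A - B)
        = (1 - p - q) ^ card B * p ^ card (A - B) * indicator (ones (B + N)) x"
      by (simp add: prod.distrib)
  qed
  finally show ?thesis .
qed

section \<open>Action of the kernel on measures and its contraction rate\<close>

lemma bind_prob: "\<nu> \<in> space (prob_algebra borel) \<Longrightarrow> \<nu> \<bind> \<Phi> \<in> space (prob_algebra borel)"
  using PCA prob_space_bind'[of \<nu> borel \<Phi> borel] sets_bind'[of \<nu> borel \<Phi> borel]
  by (simp add: is_PCA_def space_prob_algebra)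

lemma evolve_prob: "\<nu> \<in> space (prob_algebra borel) \<Longrightarrow> evolve t \<nu> \<in> space (prob_algebra borel)"
  by (induction t) (simp_all add: bind_prob)

text \<open>Integrating the duality formula against \<open>\<nu>\<close> makes one step of the chain
  a finite linear relation among all-ones probabilities.\<close>

lemma bind_ones:
  assumes \<nu>: "\<nu> \<in> space (prob_algebra borel)" and A: "finite A"
  shows "measure (\<nu> \<bind> \<Phi>) (ones A) =
    (\<Sum>B\<in>Pow A. (1 - p - q) ^ card B * p ^ card (A - B) * measure \<nu> (ones (B + N)))"
proof -
  have sets[measurable_cong]: "sets \<nu> = sets borel" and "prob_space \<nu>"
    using \<nu> by (auto simp: space_prob_algebra)
  then interpret prob_space \<nu> by simp
  have fin: "finite (B + N)" if "B \<in> Pow A" for B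
    using that A finN finite_subset by (auto intro: finite_set_plus)
  have meas: "ones (B + N) \<in> sets \<nu>" if "B \<in> Pow A" for B
    using fin[OF that] by (simp add: sets cylinder_sets)
  have "\<Phi> \<in> \<nu> \<rightarrow>\<^sub>M subprob_algebra borel"
    using PCA measurable_prob_algebraD[of \<Phi> borel borel]
    by (simp add: is_PCA_def measurable_cong_sets[OF sets refl])
  then have "measure (\<nu> \<bind> \<Phi>) (ones A) = (\<integral>x. measure (\<Phi> x) (ones A) \<partial>\<nu>)"
    using A by (intro measure_bind) (auto simp: cylinder_sets)
  also have "\<dots> = (\<Sum>B\<in>Pow A. (1 - p - q) ^ card B * p ^ card (A - B) * measure \<nu> (ones (B + N)))"
    unfolding kernel_ones[OF A] using meas
    by (subst Bochner_Integration.integral_sum)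
      (auto intro!: sum.cong integrable_mult_right integrable_real_indicator
        simp: emeasure_eq_measure)
  finally show ?thesis .
qed

text \<open>Each step gains a factor \<open>rate\<close>, the bound for the sum of the absolute
  coefficients of a nonempty set. The bound must be uniform in \<open>A\<close>, since the recursion
  passes to the possibly larger sets \<open>B + N\<close>.\<close>

lemma evolve_contraction:
  assumes \<nu>: "\<nu> \<in> space (prob_algebra borel)" "\<nu>' \<in> space (prob_algebra borel)" and "finite A"
  shows "\<bar>measure (evolve t \<nu>) (ones A) - measure (evolve t \<nu>') (ones A)\<bar> \<le> rate ^ t"
  using \<open>finite A\<close>
proof (induction t arbitrary: A)
  case 0
  have "prob_space \<nu>" "prob_space \<nu>'" using \<nu> by (auto simp: space_prob_algebra)
  then have "measure \<nu> (ones A) \<le> 1" "measure \<nu>' (ones A) \<le> 1"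
    by (auto intro: prob_space.prob_le_1)
  then show ?case using measure_nonneg[of \<nu> "ones A"] measure_nonneg[of \<nu>' "ones A"]
    by (simp add: abs_le_iff del: measure_nonneg)
next
  case (Suc t)
  let ?d = "\<lambda>A. measure (evolve t \<nu>) (ones A) - measure (evolve t \<nu>') (ones A)"
  have rate0: "0 \<le> rate" using p01 by simp
  show ?case
  proof (cases "A = {}")
    \<comment> \<open>For the empty set the coefficients sum to 1 and nothing is gained, but both
      probabilities equal 1.\<close>
    case True
    have "measure \<mu> (ones {}) = 1" if "\<mu> \<in> space (prob_algebra borel)" for \<mu> :: "'d config measure"
    proof -
      have "prob_space \<mu>" "ones {} = space \<mu>"
        using that sets_eq_imp_space_eq[of \<mu> borel] by (auto simp: space_prob_algebra cylinder_def)
      then show ?thesis by (simp add: prob_space.prob_space)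
    qed
    then show ?thesis
      using evolve_prob[OF \<nu>(1), of "Suc t"] evolve_prob[OF \<nu>(2), of "Suc t"] True rate0
      by (simp del: funpow.simps)
  next
    case False
    have "measure (evolve (Suc t) \<nu>) (ones A) - measure (evolve (Suc t) \<nu>') (ones A)
        = (\<Sum>B\<in>Pow A. (1 - p - q) ^ card B * p ^ card (A - B) * ?d (B + N))"
      using \<nu> Suc.prems by (simp add: bind_ones evolve_prob sum_subtractf right_diff_distrib)
    also have "\<bar>\<dots>\<bar> \<le> (\<Sum>B\<in>Pow A. (\<bar>1 - p - q\<bar> ^ card B * p ^ card (A - B)) * rate ^ t)"
    proof (rule order_trans[OF sum_abs], rule sum_mono)
      fix B assume "B \<in> Pow A"
      then have "finite (B + N)" using Suc.prems finN finite_subset by (auto intro: finite_set_plus)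
      then have "\<bar>?d (B + N)\<bar> \<le> rate ^ t" by (rule Suc.IH)
      then show "\<bar>(1 - p - q) ^ card B * p ^ card (A - B) * ?d (B + N)\<bar>
          \<le> (\<bar>1 - p - q\<bar> ^ card B * p ^ card (A - B)) * rate ^ t"
        using p01 by (simp add: abs_mult power_abs mult_left_mono)
    qed
    \<comment> \<open>The binomial expansion of the duality formula is read backwards, now with
      absolute values.\<close>
    also have "\<dots> = (\<Prod>a\<in>A. \<bar>1 - p - q\<bar> + p) * rate ^ t"
      using Suc.prems by (subst prod_add) (simp_all add: sum_distrib_right)
    also have "\<dots> = rate ^ card A * rate ^ t"
      by (simp add: add.commute)
    also have "\<dots> \<le> rate ^ Suc t"
    proof -
      have "card A \<ge> 1" using False Suc.prems by (simp add: Suc_le_eq card_gt_0_iff)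
      then have "rate ^ card A \<le> rate ^ 1" using contr rate0 by (intro power_decreasing) auto
      then show ?thesis using rate0 by (simp add: mult_right_mono)
    qed
    finally show ?thesis .
  qed
qed

section \<open>Existence and uniqueness of the invariant measure, and uniform convergence\<close>

lemma rate_power_tendsto_0: "(\<lambda>t. rate ^ t) \<longlonglongrightarrow> 0"
  using contr p01 by (intro LIMSEQ_realpow_zero) auto

lemma invariant_measure_approx:
  assumes "invariant_measure \<Phi> \<pi>" "\<nu> \<in> space (prob_algebra borel)" "finite A"
  shows "\<bar>measure (evolve t \<nu>) (ones A) - measure \<pi> (ones A)\<bar> \<le> rate ^ t"
  using evolve_contraction[OF assms(2) _ assms(3), of \<pi> t] assms(1) invariant_funpow[OF assms(1)]
  by (simp add: invariant_measure_def)

lemma return_in_prob_algebra: "return borel (x :: 'd config) \<in> space (prob_algebra borel)"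
  by (simp add: space_prob_algebra prob_space_return)

text \<open>The sequence is Cauchy because a longer run is a run of length \<open>T\<close> from
  another initial law, and contraction does not see the initial law.\<close>

lemma evolve_convergent:
  assumes \<nu>: "\<nu> \<in> space (prob_algebra borel)" and A: "finite A"
  shows "convergent (\<lambda>t. measure (evolve t \<nu>) (ones A))"
proof (rule Cauchy_convergent, rule metric_CauchyI)
  fix e :: real assume "0 < e"
  then have "\<forall>\<^sub>F t in sequentially. rate ^ t < e / 2"
    by (intro order_tendstoD[OF rate_power_tendsto_0]) simp
  then obtain T where T: "rate ^ T < e / 2" by (auto simp: eventually_sequentially)
  have close: "\<bar>measure (evolve m \<nu>) (ones A) - measure (evolve T \<nu>) (ones A)\<bar> < e / 2" if "m \<ge> T" for m
  proof -
    have "evolve m \<nu> = evolve T (evolve (m - T) \<nu>)"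
      using that by (simp add: funpow_add[symmetric, THEN fun_cong, unfolded comp_def])
    then show ?thesis
      using evolve_contraction[OF evolve_prob[OF \<nu>] \<nu> A, of T "m - T"] T by simp
  qed
  show "\<exists>M. \<forall>m\<ge>M. \<forall>n\<ge>M. dist (measure (evolve m \<nu>) (ones A)) (measure (evolve n \<nu>) (ones A)) < e"
  proof (intro exI allI impI)
    fix m n assume "T \<le> m" "T \<le> n"
    then show "dist (measure (evolve m \<nu>) (ones A)) (measure (evolve n \<nu>) (ones A)) < e"
      using close[of m] close[of n] unfolding dist_real_def by linarith
  qed
qed

text \<open>The limit law of a chain is invariant because one step acts on all-ones probabilities
  through finite sums and hence passes to the limit.\<close>

lemma invariant_measure_exists: "\<exists>\<pi>. invariant_measure \<Phi> \<pi>"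
proof -
  define \<nu> :: "'d config measure" where "\<nu> = return borel (\<lambda>_. True)"
  have \<nu>: "\<nu> \<in> space (prob_algebra borel)" unfolding \<nu>_def by (rule return_in_prob_algebra)
  obtain \<pi> where \<pi>: "\<pi> \<in> space (prob_algebra borel)"
    and lim: "\<And>A. finite A \<Longrightarrow> (\<lambda>t. measure (evolve t \<nu>) (ones A)) \<longlonglongrightarrow> measure \<pi> (ones A)"
    using limit_measure_exists[of "\<lambda>t. evolve t \<nu>"] evolve_prob[OF \<nu>] evolve_convergent[OF \<nu>] by auto
  have "\<pi> \<bind> \<Phi> = \<pi>"
  proof (rule prob_measure_eqI_ones[OF bind_prob[OF \<pi>] \<pi>])
    fix A :: "(int ^ 'd) set" assume A: "finite A"
    have fin: "finite (B + N)" if "B \<in> Pow A" for B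
      using that A finN finite_subset by (auto intro: finite_set_plus)
    \<comment> \<open>The shifted sequence has two limits: one from the duality formula, the other
      from the original sequence.\<close>
    have "(\<lambda>t. measure (evolve (Suc t) \<nu>) (ones A)) \<longlonglongrightarrow> measure (\<pi> \<bind> \<Phi>) (ones A)"
      using A \<pi> \<nu> fin lim by (auto simp: bind_ones evolve_prob intro!: tendsto_intros)
    then show "measure (\<pi> \<bind> \<Phi>) (ones A) = measure \<pi> (ones A)"
      by (rule LIMSEQ_unique) (use LIMSEQ_Suc[OF lim[OF A]] in simp)
  qed
  with \<pi> show ?thesis by (auto simp: invariant_measure_def)
qed

text \<open>Both measures stay fixed under evolution while the distance between their all-ones
  probabilities is at most \<open>rate ^ t\<close> for every \<open>t\<close>.\<close>

lemma invariant_measure_unique: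
  assumes "invariant_measure \<Phi> \<pi>" "invariant_measure \<Phi> \<pi>'"
  shows "\<pi> = \<pi>'"
proof (rule prob_measure_eqI_ones)
  fix A :: "(int ^ 'd) set" assume "finite A"
  then have "\<bar>measure \<pi> (ones A) - measure \<pi>' (ones A)\<bar> \<le> rate ^ t" for t
    using invariant_measure_approx[OF assms(2), of \<pi> A t] assms(1) invariant_funpow[OF assms(1)]
    by (simp add: invariant_measure_def)
  then have "\<bar>measure \<pi> (ones A) - measure \<pi>' (ones A)\<bar> \<le> 0"
    by (intro LIMSEQ_le_const[OF rate_power_tendsto_0]) auto
  then show "measure \<pi> (ones A) = measure \<pi>' (ones A)" by simp
qed (use assms in \<open>auto simp: invariant_measure_def\<close>)

text \<open>The contraction bound does not depend on the starting point \<open>x\<close>, and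
  uniform limits survive proper differences.\<close>

lemma kernel_power_uniform_limit:
  assumes \<pi>: "invariant_measure \<Phi> \<pi>" and "finite K"
  shows "uniform_limit UNIV (\<lambda>t x. measure (kernel_power \<Phi> t x) (cylinder K u))
           (\<lambda>x. measure \<pi> (cylinder K u)) sequentially"
  using \<open>finite K\<close>
proof (induction rule: cylinder_induct_ones)
  case (ones A)
  show ?case
  proof (rule uniform_limitI)
    fix e :: real assume "0 < e"
    then have "\<forall>\<^sub>F t in sequentially. rate ^ t < e"
      by (intro order_tendstoD[OF rate_power_tendsto_0])
    then show "\<forall>\<^sub>F t in sequentially. \<forall>x\<in>UNIV.
        dist (measure (kernel_power \<Phi> t x) (ones A)) (measure \<pi> (ones A)) < e"
    proof eventually_elim
      case (elim t)
      then show ?case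
        using invariant_measure_approx[OF \<pi> return_in_prob_algebra ones, of t]
        by (auto simp: dist_real_def kernel_power_eq_funpow intro: le_less_trans)
    qed
  qed
next
  case (Diff S T)
  have "measure \<mu> (S - T) = measure \<mu> S - measure \<mu> T" if "\<mu> \<in> space (prob_algebra borel)" for \<mu>
    using that Diff
    by (auto simp: space_prob_algebra prob_space_def intro!: finite_measure.finite_measure_Diff)
  then show ?case
    using uniform_limit_minus[OF Diff(4,5)] \<pi> evolve_prob[OF return_in_prob_algebra]
    by (simp add: kernel_power_eq_funpow invariant_measure_def)
qed

section \<open>Spatial mixing of the invariant measure\<close>

lemma evolve_all_ones:
  assumes "finite A"
  shows "measure (evolve t (return borel (\<lambda>_. True))) (ones A) = dual_weight N p (1 - p - q) t A"
  using assms
proof (induction t arbitrary: A)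
  case 0
  then show ?case by (simp add: measure_return cylinder_sets) (simp add: cylinder_def)
next
  case (Suc t)
  have "finite (B + N)" if "B \<subseteq> A" for B
    using that Suc.prems finN finite_subset by (auto intro: finite_set_plus)
  then show ?case
    using Suc by (simp add: bind_ones evolve_prob return_in_prob_algebra)
qed

lemma invariant_measure_dual_weight:
  assumes "invariant_measure \<Phi> \<pi>" "finite A"
  shows "\<bar>dual_weight N p (1 - p - q) t A - measure \<pi> (ones A)\<bar> \<le> rate ^ t"
  using invariant_measure_approx[OF assms(1) return_in_prob_algebra assms(2), of t "\<lambda>_. True"]
  by (simp add: evolve_all_ones[OF assms(2)])

text \<open>At a fixed time \<open>t\<close> the dual weight approximates \<pi> with an error
  independent of \<open>k\<close>, and it factorises exactly for all but finitely many
  \<open>k\<close>. Hence \<open>t\<close> is chosen before \<open>k\<close>.\<close>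

lemma ones_mixing:
  assumes \<pi>: "invariant_measure \<Phi> \<pi>" and A: "finite A" and C: "finite C"
  shows "((\<lambda>k. measure \<pi> (ones (A \<union> (+) k ` C)))
           \<longlongrightarrow> measure \<pi> (ones A) * measure \<pi> (ones C)) cofinite"
proof (rule tendstoI)
  fix e :: real assume "0 < e"
  let ?w = "dual_weight N p (1 - p - q)"
  have "\<forall>\<^sub>F t in sequentially. rate ^ t < e / 3"
    using \<open>0 < e\<close> by (intro order_tendstoD[OF rate_power_tendsto_0]) simp
  moreover have "(\<lambda>t. ?w t A * ?w t C) \<longlonglongrightarrow> measure \<pi> (ones A) * measure \<pi> (ones C)"
  proof -
    have "(\<lambda>t. ?w t D) \<longlonglongrightarrow> measure \<pi> (ones D)" if "finite D" for D
      by (rule LIM_zero_cancel, rule tendsto_0_le[OF rate_power_tendsto_0, of _ 1])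
        (use invariant_measure_dual_weight[OF \<pi> that] p01 in \<open>auto intro!: always_eventually\<close>)
    then show ?thesis using A C by (intro tendsto_intros)
  qed
  then have "\<forall>\<^sub>F t in sequentially.
      dist (?w t A * ?w t C) (measure \<pi> (ones A) * measure \<pi> (ones C)) < e / 3"
    using \<open>0 < e\<close> by (intro tendstoD) auto
  ultimately have "\<forall>\<^sub>F t in sequentially. rate ^ t < e / 3 \<and>
      dist (?w t A * ?w t C) (measure \<pi> (ones A) * measure \<pi> (ones C)) < e / 3"
    by eventually_elim simp
  then obtain t where t: "rate ^ t < e / 3"
    and wt: "dist (?w t A * ?w t C) (measure \<pi> (ones A) * measure \<pi> (ones C)) < e / 3"
    by (auto simp: eventually_sequentially)
  let ?S = "\<lambda>s::nat. \<Sum>i<s. N"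
  \<comment> \<open>The translations \<open>k\<close> for which the enlargements of \<open>A\<close>
    and of \<open>k + C\<close> meet before time \<open>t\<close>: a common point exhibits
    \<open>k\<close> as such a difference.\<close>
  let ?bad = "\<Union>s<t. (\<lambda>(x, y). x - y) ` ((A + ?S s) \<times> (C + ?S s))"
  have finS: "finite (?S s)" for s
    by (induction s) (simp_all add: finN finite_set_plus)
  have "finite ?bad" using A C finS by (intro finite_UN_I finite_imageI finite_cartesian_product finite_set_plus) auto
  then have "\<forall>\<^sub>F k in cofinite. k \<notin> ?bad" by (simp add: eventually_cofinite)
  then show "\<forall>\<^sub>F k in cofinite. dist (measure \<pi> (ones (A \<union> (+) k ` C)))
      (measure \<pi> (ones A) * measure \<pi> (ones C)) < e"
  proof eventually_elim
    case (elim k)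
    have "(A + ?S s) \<inter> ((+) k ` C + ?S s) = {}" if "s < t" for s
    proof (rule ccontr)
      assume "\<not> ?thesis"
      then obtain x where x: "x \<in> A + ?S s" "x \<in> (+) k ` C + ?S s" by blast
      from x(2) obtain c z where "x = k + c + z" "c \<in> C" "z \<in> ?S s"
        by (auto elim!: set_plus_elim)
      then have "k = x - (c + z)" "c + z \<in> C + ?S s" by auto
      with x(1) elim that show False by force
    qed
    then have "?w t (A \<union> (+) k ` C) = ?w t A * ?w t C"
      using A C finN by (simp add: dual_weight_Un dual_weight_translate)
    then have close: "\<bar>?w t A * ?w t C - measure \<pi> (ones (A \<union> (+) k ` C))\<bar> \<le> rate ^ t"
      using invariant_measure_dual_weight[OF \<pi>, of "A \<union> (+) k ` C" t] A C by simp
    have "\<bar>a - b\<bar> < e" if "\<bar>w - a\<bar> \<le> r" "r < e / 3" "\<bar>w - b\<bar> < e / 3" for a b r w :: real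
      using that \<open>0 < e\<close> by linarith
    from this[OF close t wt[unfolded dist_real_def]] show ?case
      by (simp add: dist_real_def)
  qed
qed

text \<open>Both sides of the mixing limit are additive in each event, so the reduction to all-ones
  cylinders is done first in the shifted event and then in the fixed one.\<close>

lemma invariant_measure_spatially_mixing:
  assumes \<pi>: "invariant_measure \<Phi> \<pi>"
  shows "spatially_mixing \<pi>"
  unfolding spatially_mixing_def
proof (intro allI impI)
  fix K L :: "(int ^ 'd) set" and u v :: "'d config"
  assume K: "finite K" and L: "finite L"
  have prob: "prob_space \<pi>" and sets: "sets \<pi> = sets borel"
    using \<pi> by (auto simp: invariant_measure_def space_prob_algebra)
  interpret prob_space \<pi> by fact
  have shift_meas: "shift k -` S \<in> sets borel" if "S \<in> sets borel" for k and S :: "'d config set"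
  proof -
    have "continuous_on UNIV (shift k :: 'd config \<Rightarrow> _)"
      unfolding shift_def by (intro continuous_on_coordinatewise_then_product continuous_on_product_coordinates)
    then have "shift k \<in> borel \<rightarrow>\<^sub>M (borel :: 'd config measure)"
      by (rule borel_measurable_continuous_onI)
    from measurable_sets[OF this that] show ?thesis by simp
  qed
  let ?P = "\<lambda>S T. ((\<lambda>k. measure \<pi> (S \<inter> shift k -` T)) \<longlongrightarrow> measure \<pi> S * measure \<pi> T) cofinite"
  have ones_ones: "?P (ones A) (ones C)" if "finite A" "finite C" for A C
  proof -
    \<comment> \<open>Pulling back along \<open>shift k\<close> moves the constrained sites from
      \<open>C\<close> to \<open>k + C\<close>.\<close>
    have "ones A \<inter> shift k -` ones C = ones (A \<union> (+) k ` C)" for k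
      by (auto simp: cylinder_def shift_def)
    then show ?thesis using ones_mixing[OF \<pi> that] by simp
  qed
  have right: "?P (ones A) (cylinder L v)" if A: "finite A" for A
    using L
  proof (induction rule: cylinder_induct_ones)
    case (ones C)
    then show ?case by (rule ones_ones[OF A])
  next
    case (Diff S T)
    have eq: "ones A \<inter> shift k -` (S - T) = (ones A \<inter> shift k -` S) - (ones A \<inter> shift k -` T)" for k
      by auto
    have "measure \<pi> (ones A \<inter> shift k -` (S - T))
        = measure \<pi> (ones A \<inter> shift k -` S) - measure \<pi> (ones A \<inter> shift k -` T)" for k
      unfolding eq using Diff A
      by (intro finite_measure_Diff) (auto simp: sets intro!: sets.Int cylinder_sets shift_meas)
    moreover have "measure \<pi> (S - T) = measure \<pi> S - measure \<pi> T"
      using Diff by (intro finite_measure_Diff) (auto simp: sets)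
    ultimately show ?case using tendsto_diff[OF Diff(4,5)] by (simp add: right_diff_distrib)
  qed
  show "?P (cylinder K u) (cylinder L v)"
    using K
  proof (induction rule: cylinder_induct_ones)
    case (ones A)
    then show ?case by (rule right)
  next
    case (Diff S T)
    let ?V = "cylinder L v"
    have eq: "(S - T) \<inter> shift k -` ?V = (S \<inter> shift k -` ?V) - (T \<inter> shift k -` ?V)" for k
      by auto
    have "measure \<pi> ((S - T) \<inter> shift k -` ?V)
        = measure \<pi> (S \<inter> shift k -` ?V) - measure \<pi> (T \<inter> shift k -` ?V)" for k
      unfolding eq using Diff L
      by (intro finite_measure_Diff) (auto simp: sets intro!: sets.Int cylinder_sets shift_meas)
    moreover have "measure \<pi> (S - T) = measure \<pi> S - measure \<pi> T"
      using Diff by (intro finite_measure_Diff) (auto simp: sets)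
    ultimately show ?case using tendsto_diff[OF Diff(4,5)] by (simp add: left_diff_distrib)
  qed
qed

end

theorem theorem5p3:
  fixes N :: "(int ^ 'd::finite) set"
    and p q :: real
    and \<Phi> :: "'d config \<Rightarrow> 'd config measure"
  assumes "finite N" and "N \<noteq> {}"
    and "p \<in> {0..1}" and "q \<in> {0..1}"
    and "is_PCA (spreading_ca N) (noise_matrix p q) \<Phi>"
    and "p + \<bar>1 - p - q\<bar> < 1"
  shows "uniformly_ergodic \<Phi> \<and>
         (\<forall>\<pi>. invariant_measure \<Phi> \<pi> \<longrightarrow> spatially_mixing \<pi>)"
proof -
  note PCA = assms(1,3-6)
  obtain \<pi> where "invariant_measure \<Phi> \<pi>"
    using invariant_measure_exists[OF PCA] by blast
  then have "uniformly_ergodic \<Phi>"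
    unfolding uniformly_ergodic_def
    using invariant_measure_unique[OF PCA] kernel_power_uniform_limit[OF PCA] by blast
  then show ?thesis
    using invariant_measure_spatially_mixing[OF PCA] by blast
qed

end
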